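(* For all data $\alpha,\beta$: if $\alpha\vDash_{FDE}\beta$ then there exists a normal deduction of $\beta$ from $\alpha$ in FDEDC.
   Context: Formulas are built from propositional variables with $\neg,\wedge,\vee$. A datum is a finite set of finite sets of formulas; its elements are called components. Notation: $\Gamma,A$ is $\Gamma\cup\{A\}$; $\Gamma,\Delta$ is $\Gamma\cup\Delta$; $\Gamma/\rho$ is $\{\Gamma\}\cup\rho$ and $\Gamma/\Delta/\rho$ is $\{\Gamma,\Delta\}\cup\rho$, where $\rho$ is any datum (possibly empty, overlaps allowed). Rules of FDEDC. G-rules (each item is a pair of rules: the analytic rule infers the right side from the left side, the synthetic rule infers the left side from the right side): $\Gamma,A\wedge B/\rho$ and $\Gamma,A,B/\rho$; $\Gamma,A\vee B/\rho$ and $\Gamma,A/\Gamma,B/\rho$; $\Gamma,\neg\neg A/\rho$ and $\Gamma,A/\rho$; $\Gamma,\neg(A\vee B)/\rho$ and $\Gamma,\neg A,\neg B/\rho$; $\Gamma,\neg(A\wedge B)/\rho$ and $\Gamma,\neg A/\Gamma,\neg B/\rho$. S-rules: Del (analytic): from $\Gamma,\Delta/\rho$ infer $\Gamma/\rho$; Exp (synthetic): from $\rho$ infer $\Gamma/\rho$. A deduction of $\beta$ from $\alpha$ is a finite sequence of data starting with $\alpha$ and ending with $\beta$, each datum after the first being inferable from the immediately preceding one by a rule. It is normal if it divides into two consecutive (possibly empty) parts, the first using only analytic rules and the second only synthetic rules. Semantics. An elementary situation space is any set $S$; a state is a subset of $S$; a bilateral proposition is a pair $\langle X,Y\rangle$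 of sets of states with $X\ne Y$. A model $(S,\sigma)$ consists of an elementary situation space $S$ and a function $\sigma$ assigning a bilateral proposition $\sigma(p)=\langle\sigma^+(p),\sigma^-(p)\rangle$ to each propositional variable $p$. $\sigma$ is extended to all formulas (as pairs of sets of states) by: $\sigma^+(\neg A)=\sigma^-(A)$, $\sigma^-(\neg A)=\sigma^+(A)$; $\sigma^+(A\wedge B)=\{\Sigma_1\cup\Sigma_2:\Sigma_1\in\sigma^+(A),\Sigma_2\in\sigma^+(B)\}$, $\sigma^-(A\wedge B)=\sigma^-(A)\cup\sigma^-(B)$; $\sigma^+(A\vee B)=\sigma^+(A)\cup\sigma^+(B)$, $\sigma^-(A\vee B)=\{\Sigma_1\cup\Sigma_2:\Sigma_1\in\sigma^-(A),\Sigma_2\in\sigma^-(B)\}$. Data are treated as the corresponding disjunctions of conjunctions: for a component $\Gamma$, $\sigma^+(\Gamma)$ is the set of all unions $\bigcup_{A\in\Gamma}\Sigma_A$ with $\Sigma_A\in\sigma^+(A)$ (so $\{\varnothing\}$ if $\Gamma=\varnothing$), and $\sigma^+(\alpha)=\bigcup_{\Gamma\in\alpha}\sigma^+(\Gamma)$. Then $\alpha\vDash_{FDE}\beta$ means: for every model $(S,\sigma)$ and every $\Sigma\in\sigma^+(\alpha)$ there is $\Sigma'\in\sigma^+(\beta)$ with $\Sigma'\subseteq\Sigma$. *)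

theory Defs
  imports Main "HOL-Library.FSet"
begin

datatype 'v fm =
    Var 'v
  | Neg "'v fm"
  | Conj "'v fm" "'v fm"
  | Disj "'v fm" "'v fm"

type_synonym 'v component = "'v fm fset"
type_synonym 'v datum = "'v component fset"

text \<open>
  The context \<open>\<Gamma>\<close> may already contain the displayed formulas and the datum \<open>\<rho>\<close> may already
  contain the displayed components.
\<close>

inductive g_rule :: "'v datum \<Rightarrow> 'v datum \<Rightarrow> bool" where
  conj: "g_rule (finsert (finsert (Conj A B) \<Gamma>) \<rho>) (finsert (finsert A (finsert B \<Gamma>)) \<rho>)"
| disj: "g_rule (finsert (finsert (Disj A B) \<Gamma>) \<rho>)
                (finsert (finsert A \<Gamma>) (finsert (finsert B \<Gamma>) \<rho>))"
| neg_neg: "g_rule (finsert (finsert (Neg (Neg A)) \<Gamma>) \<rho>) (finsert (finsert A \<Gamma>) \<rho>)"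
| neg_disj: "g_rule (finsert (finsert (Neg (Disj A B)) \<Gamma>) \<rho>)
                    (finsert (finsert (Neg A) (finsert (Neg B) \<Gamma>)) \<rho>)"
| neg_conj: "g_rule (finsert (finsert (Neg (Conj A B)) \<Gamma>) \<rho>)
                    (finsert (finsert (Neg A) \<Gamma>) (finsert (finsert (Neg B) \<Gamma>) \<rho>))"

inductive analytic :: "'v datum \<Rightarrow> 'v datum \<Rightarrow> bool" where
  G: "g_rule \<alpha> \<beta> \<Longrightarrow> analytic \<alpha> \<beta>"
| Del: "analytic (finsert (\<Gamma> |\<union>| \<Delta>) \<rho>) (finsert \<Gamma> \<rho>)"

inductive synthetic :: "'v datum \<Rightarrow> 'v datum \<Rightarrow> bool" where
  G: "g_rule \<beta> \<alpha> \<Longrightarrow> synthetic \<alpha> \<beta>"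
| Exp: "synthetic \<rho> (finsert \<Gamma> \<rho>)"

definition deduction :: "'v datum \<Rightarrow> 'v datum \<Rightarrow> 'v datum list \<Rightarrow> bool" where
  "deduction \<alpha> \<beta> ds \<longleftrightarrow>
     ds \<noteq> [] \<and> hd ds = \<alpha> \<and> last ds = \<beta> \<and>
     successively (\<lambda>\<gamma> \<delta>. analytic \<gamma> \<delta> \<or> synthetic \<gamma> \<delta>) ds"

text \<open>
  The two parts of a normal deduction are blocks of inference steps, so they share the
  datum \<open>\<gamma>\<close> at which the analytic part ends and the synthetic part begins.
\<close>

definition normal_deduction :: "'v datum \<Rightarrow> 'v datum \<Rightarrow> 'v datum list \<Rightarrow> bool" where
  "normal_deduction \<alpha> \<beta> ds \<longleftrightarrow>
     deduction \<alpha> \<beta> ds \<and>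
     (\<exists>ds1 \<gamma> ds2. ds = ds1 @ \<gamma> # ds2 \<and>
        successively analytic (ds1 @ [\<gamma>]) \<and> successively synthetic (\<gamma> # ds2))"

type_synonym 's state = "'s set"

definition bilateral_prop :: "'s set \<Rightarrow> 's state set \<times> 's state set \<Rightarrow> bool" where
  "bilateral_prop S P \<longleftrightarrow> fst P \<subseteq> Pow S \<and> snd P \<subseteq> Pow S \<and> fst P \<noteq> snd P"

definition is_model :: "'s set \<Rightarrow> ('v \<Rightarrow> 's state set \<times> 's state set) \<Rightarrow> bool" where
  "is_model S \<sigma> \<longleftrightarrow> (\<forall>p. bilateral_prop S (\<sigma> p))"

primrec eval_fm :: "('v \<Rightarrow> 's state set \<times> 's state set) \<Rightarrow> 'v fm \<Rightarrow> 's state set \<times> 's state set"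
where
  "eval_fm \<sigma> (Var p) = \<sigma> p"
| "eval_fm \<sigma> (Neg A) = (snd (eval_fm \<sigma> A), fst (eval_fm \<sigma> A))"
| "eval_fm \<sigma> (Conj A B) =
     ({X \<union> Y | X Y. X \<in> fst (eval_fm \<sigma> A) \<and> Y \<in> fst (eval_fm \<sigma> B)},
      snd (eval_fm \<sigma> A) \<union> snd (eval_fm \<sigma> B))"
| "eval_fm \<sigma> (Disj A B) =
     (fst (eval_fm \<sigma> A) \<union> fst (eval_fm \<sigma> B),
      {X \<union> Y | X Y. X \<in> snd (eval_fm \<sigma> A) \<and> Y \<in> snd (eval_fm \<sigma> B)})"

definition eval_component ::
  "('v \<Rightarrow> 's state set \<times> 's state set) \<Rightarrow> 'v component \<Rightarrow> 's state set" where
  "eval_component \<sigma> \<Gamma> =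
     {(\<Union>A\<in>fset \<Gamma>. f A) | f. \<forall>A\<in>fset \<Gamma>. f A \<in> fst (eval_fm \<sigma> A)}"

definition eval_datum ::
  "('v \<Rightarrow> 's state set \<times> 's state set) \<Rightarrow> 'v datum \<Rightarrow> 's state set" where
  "eval_datum \<sigma> \<alpha> = (\<Union>\<Gamma>\<in>fset \<alpha>. eval_component \<sigma> \<Gamma>)"

text \<open>
  HOL cannot quantify over all types inside a formula, so the type \<open>'s\<close> from which the
  elementary situations are drawn is a parameter: \<open>S\<close> ranges over all sets of elements
  of \<open>'s\<close>. Entailment over all elementary situation spaces implies entailment at each
  particular \<open>'s\<close>.
\<close>

definition fde_entails :: "'s itself \<Rightarrow> 'v datum \<Rightarrow> 'v datum \<Rightarrow> bool" where
  "fde_entails t \<alpha> \<beta> \<longleftrightarrow>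
     (\<forall>(S :: 's set) (\<sigma> :: 'v \<Rightarrow> 's state set \<times> 's state set).
        is_model S \<sigma> \<longrightarrow>
        (\<forall>X\<in>eval_datum \<sigma> \<alpha>. \<exists>Y\<in>eval_datum \<sigma> \<beta>. Y \<subseteq> X))"

end

(*
  The G-rules are invertible, so they reduce alpha and beta to data alpha' and beta' whose
  components consist of literals only; read backwards, the second reduction is synthetic.
  For the G-rules and for entailment only the upward closure of the interpretations matters,
  and there conjunction and disjunction are evaluated classically.
  If every component of alpha' includes a component of beta', then Del and Exp lead from
  alpha' to beta'.  For a component G of alpha' including none, there is a countermodel in
  which each literal of G has a situation of its own and every verifier of a literal outside
  G contains one further situation.
*)
theory Submission imports Defs begin

section \<open>Upward closed evaluation\<close>

text \<open>Membership of \<open>X\<close> in the upward closure of the positive interpretation of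
  \<open>A\<close>. Entailment compares verifiers only up to inclusion, so nothing finer is
  needed.\<close>

definition verifies ::
  "('v \<Rightarrow> 's state set \<times> 's state set) \<Rightarrow> 's state \<Rightarrow> 'v fm \<Rightarrow> bool" where
  "verifies \<sigma> X A \<longleftrightarrow> (\<exists>Y\<in>fst (eval_fm \<sigma> A). Y \<subseteq> X)"

definition datum_verified ::
  "('v \<Rightarrow> 's state set \<times> 's state set) \<Rightarrow> 's state \<Rightarrow> 'v datum \<Rightarrow> bool" where
  "datum_verified \<sigma> X \<alpha> \<longleftrightarrow> (\<exists>\<Gamma>\<in>fset \<alpha>. \<forall>A\<in>fset \<Gamma>. verifies \<sigma> X A)"

lemma upward_union:
  "(\<exists>Z\<in>{Y \<union> Y' | Y Y'. Y \<in> P \<and> Y' \<in> Q}. Z \<subseteq> X) \<longleftrightarrow> (\<exists>Y\<in>P. Y \<subseteq> X) \<and> (\<exists>Y\<in>Q. Y \<subseteq> X)"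
  by (auto; metis Un_least)

lemma verifies_simps [simp]:
  "verifies \<sigma> X (Conj A B) \<longleftrightarrow> verifies \<sigma> X A \<and> verifies \<sigma> X B"
  "verifies \<sigma> X (Disj A B) \<longleftrightarrow> verifies \<sigma> X A \<or> verifies \<sigma> X B"
  "verifies \<sigma> X (Neg (Neg A)) \<longleftrightarrow> verifies \<sigma> X A"
  "verifies \<sigma> X (Neg (Disj A B)) \<longleftrightarrow> verifies \<sigma> X (Neg A) \<and> verifies \<sigma> X (Neg B)"
  "verifies \<sigma> X (Neg (Conj A B)) \<longleftrightarrow> verifies \<sigma> X (Neg A) \<or> verifies \<sigma> X (Neg B)"
  by (simp_all only: verifies_def eval_fm.simps fst_conv snd_conv upward_union bex_Un)

text \<open>From right to left, choose below \<open>X\<close> one verifier for each formula of the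
  component; their union is a verifier of the component and still lies below
  \<open>X\<close>.\<close>

lemma eval_component_upward:
  "(\<exists>Y\<in>eval_component \<sigma> \<Gamma>. Y \<subseteq> X) \<longleftrightarrow> (\<forall>A\<in>fset \<Gamma>. verifies \<sigma> X A)"
proof
  assume "\<exists>Y\<in>eval_component \<sigma> \<Gamma>. Y \<subseteq> X"
  then show "\<forall>A\<in>fset \<Gamma>. verifies \<sigma> X A"
    unfolding eval_component_def verifies_def by blast
next
  assume "\<forall>A\<in>fset \<Gamma>. verifies \<sigma> X A"
  then obtain f where f: "\<forall>A\<in>fset \<Gamma>. f A \<in> fst (eval_fm \<sigma> A) \<and> f A \<subseteq> X"
    unfolding verifies_def by metis
  then have "(\<Union>A\<in>fset \<Gamma>. f A) \<in> eval_component \<sigma> \<Gamma>"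
    unfolding eval_component_def by blast
  moreover have "(\<Union>A\<in>fset \<Gamma>. f A) \<subseteq> X" using f by blast
  ultimately show "\<exists>Y\<in>eval_component \<sigma> \<Gamma>. Y \<subseteq> X" by blast
qed

lemma eval_datum_upward:
  "(\<exists>Y\<in>eval_datum \<sigma> \<alpha>. Y \<subseteq> X) \<longleftrightarrow> datum_verified \<sigma> X \<alpha>"
  unfolding datum_verified_def eval_datum_def eval_component_upward [symmetric] by blast

text \<open>A verified \<open>X\<close> need not be a verifier itself, but entailment applies to a
  verifier below it, and inclusion is transitive. Conversely, every verifier lies below
  itself.\<close>

lemma fde_entails_iff_verified:
  "fde_entails TYPE('s) \<alpha> \<beta> \<longleftrightarrow>
     (\<forall>(S :: 's set) \<sigma> X. is_model S \<sigma> \<longrightarrow> datum_verified \<sigma> X \<alpha> \<longrightarrow> datum_verified \<sigma> X \<beta>)"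
  unfolding fde_entails_def eval_datum_upward [symmetric] by (meson order_refl order_trans)

text \<open>Being an equivalence, this transfers entailment to the reduced data on both
  sides.\<close>

lemma g_rule_verified:
  assumes "g_rule \<alpha> \<beta>"
  shows "datum_verified \<sigma> X \<alpha> \<longleftrightarrow> datum_verified \<sigma> X \<beta>"
  using assms by cases (auto simp: datum_verified_def)

lemma g_rules_verified:
  assumes "g_rule\<^sup>*\<^sup>* \<alpha> \<beta>"
  shows "datum_verified \<sigma> X \<alpha> \<longleftrightarrow> datum_verified \<sigma> X \<beta>"
  using assms by induction (auto simp: g_rule_verified)

section \<open>Reduction to literals\<close>

definition literal :: "'v fm \<Rightarrow> bool" where
  "literal A \<longleftrightarrow> (\<exists>p. A = Var p \<or> A = Neg (Var p))"

definition literal_datum :: "'v datum \<Rightarrow> bool" where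
  "literal_datum \<alpha> \<longleftrightarrow> (\<forall>\<Gamma>\<in>fset \<alpha>. \<forall>A\<in>fset \<Gamma>. literal A)"

lemma literal_datum_union [simp]:
  "literal_datum (\<alpha> |\<union>| \<beta>) \<longleftrightarrow> literal_datum \<alpha> \<and> literal_datum \<beta>"
  unfolding literal_datum_def by auto

text \<open>The weight 2 of the binary connectives pays for the extra negation in the formulas
  \<open>Neg A\<close> and \<open>Neg B\<close> produced by the De Morgan rules.\<close>

primrec fm_weight :: "'v fm \<Rightarrow> nat" where
  "fm_weight (Var p) = 1"
| "fm_weight (Neg A) = fm_weight A + 1"
| "fm_weight (Conj A B) = fm_weight A + fm_weight B + 2"
| "fm_weight (Disj A B) = fm_weight A + fm_weight B + 2"

definition component_weight :: "'v component \<Rightarrow> nat" where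
  "component_weight \<Gamma> = sum fm_weight (fset \<Gamma>)"

text \<open>Only an inequality, since \<open>A\<close> may already belong to
  \<open>\<Gamma>\<close>. It bounds the components that a rule produces.\<close>

lemma component_weight_finsert_le:
  "component_weight (finsert A \<Gamma>) \<le> fm_weight A + component_weight \<Gamma>"
  unfolding component_weight_def by (simp add: sum.insert_if)

lemma component_weight_finsert2_le:
  "component_weight (finsert A (finsert B \<Gamma>)) \<le> fm_weight A + fm_weight B + component_weight \<Gamma>"
  using component_weight_finsert_le [of A "finsert B \<Gamma>"] component_weight_finsert_le [of B \<Gamma>]
  by simp

lemma component_weight_finsert:
  "A |\<notin>| \<Gamma> \<Longrightarrow> component_weight (finsert A \<Gamma>) = fm_weight A + component_weight \<Gamma>"
  unfolding component_weight_def by simp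

lemma nonliteral_cases:
  assumes "\<not> literal A"
  obtains B C where "A = Conj B C" | B C where "A = Disj B C" | B where "A = Neg (Neg B)"
    | B C where "A = Neg (Disj B C)" | B C where "A = Neg (Conj B C)"
  using assms unfolding literal_def by (metis fm.exhaust)

text \<open>Induction on the weight of the component. The context \<open>\<rho>\<close> is arbitrary
  because a branching rule yields two components: while one is reduced, the other, or its reduct,
  waits in the context.\<close>

lemma component_reduction:
  "\<exists>\<delta>. literal_datum \<delta> \<and> g_rule\<^sup>*\<^sup>* (finsert \<Gamma> \<rho>) (\<delta> |\<union>| \<rho>)"
proof (induction "component_weight \<Gamma>" arbitrary: \<Gamma> \<rho> rule: less_induct)
  case less
  have unary: ?case if "g_rule (finsert \<Gamma> \<rho>) (finsert \<Gamma>' \<rho>)"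
    and "component_weight \<Gamma>' < component_weight \<Gamma>" for \<Gamma>'
    using less [OF that(2), of \<rho>] that(1) by (meson converse_rtranclp_into_rtranclp)
  have binary: ?case if step: "g_rule (finsert \<Gamma> \<rho>) (finsert \<Gamma>' (finsert \<Gamma>'' \<rho>))"
    and w: "component_weight \<Gamma>' < component_weight \<Gamma>"
    "component_weight \<Gamma>'' < component_weight \<Gamma>" for \<Gamma>' \<Gamma>''
  proof -
    obtain \<delta>1 where 1: "literal_datum \<delta>1"
      "g_rule\<^sup>*\<^sup>* (finsert \<Gamma>' (finsert \<Gamma>'' \<rho>)) (\<delta>1 |\<union>| finsert \<Gamma>'' \<rho>)"
      using less [OF w(1)] by blast
    obtain \<delta>2 where 2: "literal_datum \<delta>2"
      "g_rule\<^sup>*\<^sup>* (finsert \<Gamma>'' (\<delta>1 |\<union>| \<rho>)) (\<delta>2 |\<union>| (\<delta>1 |\<union>| \<rho>))"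
      using less [OF w(2)] by blast
    have "g_rule\<^sup>*\<^sup>* (finsert \<Gamma> \<rho>) (\<delta>2 |\<union>| (\<delta>1 |\<union>| \<rho>))"
      using step 1(2) 2(2) by simp
    then have "g_rule\<^sup>*\<^sup>* (finsert \<Gamma> \<rho>) ((\<delta>2 |\<union>| \<delta>1) |\<union>| \<rho>)"
      by (simp add: sup_assoc)
    moreover have "literal_datum (\<delta>2 |\<union>| \<delta>1)" using 1(1) 2(1) by simp
    ultimately show ?thesis by blast
  qed
  show ?case
  proof (cases "\<forall>A\<in>fset \<Gamma>. literal A")
    case True
    then have "literal_datum {|\<Gamma>|}" by (simp add: literal_datum_def)
    moreover have "g_rule\<^sup>*\<^sup>* (finsert \<Gamma> \<rho>) ({|\<Gamma>|} |\<union>| \<rho>)" by simp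
    ultimately show ?thesis by blast
  next
    case False
    then obtain A where A: "A |\<in>| \<Gamma>" "\<not> literal A" by blast
    \<comment> \<open>The rules allow a context that still contains \<open>A\<close>, in which case
      \<open>A\<close> would survive. Taking \<open>\<Delta>\<close> without \<open>A\<close> makes
      the weight drop.\<close>
    then obtain \<Delta> where \<Gamma>: "\<Gamma> = finsert A \<Delta>" and "A |\<notin>| \<Delta>"
      by (meson mk_disjoint_finsert)
    note w = component_weight_finsert [OF this(2)]
    from A(2) show ?thesis
    proof (cases A rule: nonliteral_cases)
      case (1 B C)
      then show ?thesis
        using unary g_rule.conj [of B C \<Delta> \<rho>] w component_weight_finsert2_le [of B C \<Delta>]
        unfolding \<Gamma> by simp
    next
      case (2 B C)
      then show ?thesis
        using binary g_rule.disj [of B C \<Delta> \<rho>] w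
          component_weight_finsert_le [of B \<Delta>] component_weight_finsert_le [of C \<Delta>]
        unfolding \<Gamma> by simp
    next
      case (3 B)
      then show ?thesis
        using unary g_rule.neg_neg [of B \<Delta> \<rho>] w component_weight_finsert_le [of B \<Delta>]
        unfolding \<Gamma> by simp
    next
      case (4 B C)
      then show ?thesis
        using unary g_rule.neg_disj [of B C \<Delta> \<rho>] w
          component_weight_finsert2_le [of "Neg B" "Neg C" \<Delta>]
        unfolding \<Gamma> by simp
    next
      case (5 B C)
      then show ?thesis
        using binary g_rule.neg_conj [of B C \<Delta> \<rho>] w
          component_weight_finsert_le [of "Neg B" \<Delta>] component_weight_finsert_le [of "Neg C" \<Delta>]
        unfolding \<Gamma> by simp
    qed
  qed
qed

lemma datum_reduction_in_context:
  "\<exists>\<delta>. literal_datum \<delta> \<and> g_rule\<^sup>*\<^sup>* (\<alpha> |\<union>| \<rho>) (\<delta> |\<union>| \<rho>)"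
proof (induction \<alpha> arbitrary: \<rho>)
  case empty
  have "literal_datum {||}" by (simp add: literal_datum_def)
  then show ?case by blast
next
  case (insert \<Gamma> \<alpha>)
  obtain \<delta>1 where 1: "literal_datum \<delta>1"
    "g_rule\<^sup>*\<^sup>* (finsert \<Gamma> (\<alpha> |\<union>| \<rho>)) (\<delta>1 |\<union>| (\<alpha> |\<union>| \<rho>))"
    using component_reduction by blast
  obtain \<delta>2 where 2: "literal_datum \<delta>2"
    "g_rule\<^sup>*\<^sup>* (\<alpha> |\<union>| (\<delta>1 |\<union>| \<rho>)) (\<delta>2 |\<union>| (\<delta>1 |\<union>| \<rho>))"
    using insert.IH by blast
  have "g_rule\<^sup>*\<^sup>* (finsert \<Gamma> \<alpha> |\<union>| \<rho>) ((\<delta>2 |\<union>| \<delta>1) |\<union>| \<rho>)"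
    using 1(2) 2(2) by (simp add: sup_assoc sup_left_commute)
  moreover have "literal_datum (\<delta>2 |\<union>| \<delta>1)" using 1(1) 2(1) by simp
  ultimately show ?case by blast
qed

lemma datum_reduction:
  obtains \<delta> where "literal_datum \<delta>" "g_rule\<^sup>*\<^sup>* \<alpha> \<delta>"
  using datum_reduction_in_context [of \<alpha> "{||}"] by auto

lemma g_rules_analytic: "g_rule\<^sup>*\<^sup>* \<alpha> \<beta> \<Longrightarrow> analytic\<^sup>*\<^sup>* \<alpha> \<beta>"
  by (rule mono_rtranclp [rule_format]) (rule analytic.G)

lemma g_rules_synthetic: "g_rule\<^sup>*\<^sup>* \<alpha> \<beta> \<Longrightarrow> synthetic\<^sup>*\<^sup>* \<beta> \<alpha>"
  by (induction rule: rtranclp_induct)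
    (auto intro: synthetic.G converse_rtranclp_into_rtranclp)

section \<open>Literal data\<close>

text \<open>The state \<open>X\<close> collects the situations assigned to the members of
  \<open>\<Gamma>\<close>. Components can be arbitrarily large, and an infinite type has enough
  situations for all of them.\<close>

lemma literal_component_countermodel:
  fixes \<Gamma> :: "'v component"
  assumes inf: "infinite (UNIV :: 's set)"
  obtains \<sigma> :: "'v \<Rightarrow> 's state set \<times> 's state set" and X
  where "is_model UNIV \<sigma>" "\<And>A. literal A \<Longrightarrow> verifies \<sigma> X A \<longleftrightarrow> A |\<in>| \<Gamma>"
proof -
  obtain g :: "nat \<Rightarrow> 's" where g: "inj g"
    using infinite_countable_subset [OF inf] by blast
  obtain h :: "'v fm \<Rightarrow> nat" where h: "inj_on h (fset \<Gamma>)"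
    using finite_imp_inj_to_nat_seg [OF finite_fset [of \<Gamma>]] by blast
  \<comment> \<open>The situation \<open>g 0\<close> is reserved for literals outside
    \<open>\<Gamma>\<close>; \<open>Suc\<close> keeps the members of \<open>\<Gamma>\<close> away
    from it.\<close>
  define f where "f A = (if A |\<in>| \<Gamma> then g (Suc (h A)) else g 0)" for A
  have f_eq: "f A = f B \<longleftrightarrow> A = B" if "A |\<in>| \<Gamma>" for A B
    using that inj_onD [OF h] by (auto simp: f_def inj_eq [OF g])
  have f_image: "f A \<in> f ` fset \<Gamma> \<longleftrightarrow> A |\<in>| \<Gamma>" for A
    using f_eq by (metis image_iff)
  \<comment> \<open>If \<open>Neg (Var p)\<close> is outside \<open>\<Gamma>\<close>, it gets no
    verifier at all: with \<open>{{g 0}}\<close> on both sides, the two halves of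
    \<open>\<sigma> p\<close> could coincide, which a bilateral proposition forbids.\<close>
  define \<sigma> :: "'v \<Rightarrow> 's state set \<times> 's state set" where
    "\<sigma> p = ({{f (Var p)}}, if Neg (Var p) |\<in>| \<Gamma> then {{f (Neg (Var p))}} else {})" for p
  have "is_model UNIV \<sigma>"
    unfolding is_model_def bilateral_prop_def
    by (auto simp: \<sigma>_def f_eq eq_commute [of "f (Var _)"])
  moreover have "verifies \<sigma> (f ` fset \<Gamma>) A \<longleftrightarrow> A |\<in>| \<Gamma>" if "literal A" for A
    using that by (auto simp: literal_def verifies_def \<sigma>_def f_image simp del: image_iff split: if_splits)
  ultimately show ?thesis using that by blast
qed

text \<open>At the state of the countermodel for \<open>\<Gamma>\<close>, \<open>\<alpha>\<close> is
  verified through \<open>\<Gamma>\<close>. Hence some component of \<open>\<beta>\<close> is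
  verified there, and its literals all belong to \<open>\<Gamma>\<close>.\<close>

lemma literal_datum_entails:
  fixes \<alpha> \<beta> :: "'v datum"
  assumes "infinite (UNIV :: 's set)" "fde_entails TYPE('s) \<alpha> \<beta>"
    and lit: "literal_datum \<alpha>" "literal_datum \<beta>" and "\<Gamma> |\<in>| \<alpha>"
  shows "\<exists>\<Delta>. \<Delta> |\<in>| \<beta> \<and> \<Delta> |\<subseteq>| \<Gamma>"
proof -
  obtain \<sigma> :: "'v \<Rightarrow> 's state set \<times> 's state set" and X where m: "is_model UNIV \<sigma>"
    and v: "\<And>A. literal A \<Longrightarrow> verifies \<sigma> X A \<longleftrightarrow> A |\<in>| \<Gamma>"
    using literal_component_countermodel [OF assms(1), of \<Gamma>] by metis
  have "datum_verified \<sigma> X \<alpha>"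
    using \<open>\<Gamma> |\<in>| \<alpha>\<close> lit(1) v unfolding datum_verified_def literal_datum_def by blast
  then have "datum_verified \<sigma> X \<beta>"
    using assms(2) m unfolding fde_entails_iff_verified by blast
  then show ?thesis
    using lit(2) v unfolding datum_verified_def literal_datum_def by blast
qed

text \<open>Each component shrinks to a component of \<open>\<beta>\<close> included in it.
  Components of \<open>\<beta>\<close> that are never chosen may be missing from
  \<open>\<gamma>\<close>; Exp supplies them later.\<close>

lemma Del_steps:
  assumes "\<And>\<Gamma>. \<Gamma> |\<in>| \<alpha> \<Longrightarrow> \<exists>\<Delta>. \<Delta> |\<in>| \<beta> \<and> \<Delta> |\<subseteq>| \<Gamma>"
  shows "\<exists>\<gamma>. \<gamma> |\<subseteq>| \<beta> \<and> analytic\<^sup>*\<^sup>* (\<alpha> |\<union>| \<rho>) (\<gamma> |\<union>| \<rho>)"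
  using assms
proof (induction \<alpha> arbitrary: \<rho>)
  case empty
  then show ?case by blast
next
  case (insert \<Gamma> \<alpha>)
  obtain \<Delta> where \<Delta>: "\<Delta> |\<in>| \<beta>" "\<Delta> |\<subseteq>| \<Gamma>" using insert.prems by blast
  have "analytic (finsert \<Gamma> (\<alpha> |\<union>| \<rho>)) (finsert \<Delta> (\<alpha> |\<union>| \<rho>))"
    using analytic.Del [of \<Delta> \<Gamma>] \<Delta>(2) by (simp add: sup_absorb2)
  \<comment> \<open>The shrunk component \<open>\<Delta>\<close> moves into the context while the
    rest of \<open>\<alpha>\<close> is treated.\<close>
  moreover obtain \<gamma> where "\<gamma> |\<subseteq>| \<beta>"
    "analytic\<^sup>*\<^sup>* (\<alpha> |\<union>| finsert \<Delta> \<rho>) (\<gamma> |\<union>| finsert \<Delta> \<rho>)"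
    using insert.IH insert.prems by (meson finsertI2)
  ultimately have "finsert \<Delta> \<gamma> |\<subseteq>| \<beta>"
    "analytic\<^sup>*\<^sup>* (finsert \<Gamma> \<alpha> |\<union>| \<rho>) (finsert \<Delta> \<gamma> |\<union>| \<rho>)"
    using \<Delta>(1) by simp_all
  then show ?case by blast
qed

lemma Exp_steps: "synthetic\<^sup>*\<^sup>* \<rho> (\<alpha> |\<union>| \<rho>)"
  by (induction \<alpha>) (auto intro: synthetic.Exp rtranclp.rtrancl_into_rtrancl)

section \<open>Normal deductions\<close>

lemma rtranclp_successively_from:
  assumes "R\<^sup>*\<^sup>* a b"
  shows "\<exists>xs. successively R (a # xs) \<and> last (a # xs) = b"
  using assms
proof (induction rule: converse_rtranclp_induct)
  case base
  have "successively R [b] \<and> last [b] = b" by simp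
  then show ?case by blast
next
  case (step x y)
  then obtain xs where "successively R (y # xs)" "last (y # xs) = b" by blast
  then have "successively R (x # y # xs) \<and> last (x # y # xs) = b"
    using step by simp
  then show ?case by blast
qed

text \<open>Isolates the last element instead of the first, so that the analytic chain can be glued
  to the synthetic one at their common datum.\<close>

lemma rtranclp_successively_to:
  assumes "R\<^sup>*\<^sup>* a b"
  shows "\<exists>xs. successively R (xs @ [b]) \<and> hd (xs @ [b]) = a"
proof -
  obtain xs where "successively R (a # xs)" "last (a # xs) = b"
    using rtranclp_successively_from [OF assms] by blast
  then have "successively R (butlast (a # xs) @ [b]) \<and> hd (butlast (a # xs) @ [b]) = a"
    by (metis append_butlast_last_id list.distinct(1) list.sel(1))
  then show ?thesis by blast
qed

lemma normal_deductionI: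
  assumes "analytic\<^sup>*\<^sup>* \<alpha> \<gamma>" "synthetic\<^sup>*\<^sup>* \<gamma> \<beta>"
  shows "\<exists>ds. normal_deduction \<alpha> \<beta> ds"
proof -
  obtain ds1 where 1: "successively analytic (ds1 @ [\<gamma>])" "hd (ds1 @ [\<gamma>]) = \<alpha>"
    using rtranclp_successively_to [OF assms(1)] by blast
  obtain ds2 where 2: "successively synthetic (\<gamma> # ds2)" "last (\<gamma> # ds2) = \<beta>"
    using rtranclp_successively_from [OF assms(2)] by blast
  let ?R = "\<lambda>\<gamma> \<delta>. analytic \<gamma> \<delta> \<or> synthetic \<gamma> \<delta>"
  have "successively ?R (ds1 @ [\<gamma>])" "successively ?R (\<gamma> # ds2)"
    using 1(1) 2(1) by (auto elim!: successively_mono)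
  then have "successively ?R (ds1 @ \<gamma> # ds2)"
    by (simp add: successively_append_iff)
  moreover have "hd (ds1 @ \<gamma> # ds2) = \<alpha>" using 1(2) by (cases ds1) auto
  ultimately have "deduction \<alpha> \<beta> (ds1 @ \<gamma> # ds2)"
    using 2(2) unfolding deduction_def by simp
  then show ?thesis
    using 1(1) 2(1) unfolding normal_deduction_def by blast
qed

theorem mainTheorem4:
  fixes \<alpha> \<beta> :: "'v datum"
  assumes "infinite (UNIV :: 's set)"
    and "fde_entails TYPE('s) \<alpha> \<beta>"
  shows "\<exists>ds. normal_deduction \<alpha> \<beta> ds"
proof -
  obtain \<alpha>' where \<alpha>': "literal_datum \<alpha>'" "g_rule\<^sup>*\<^sup>* \<alpha> \<alpha>'"
    by (rule datum_reduction)
  obtain \<beta>' where \<beta>': "literal_datum \<beta>'" "g_rule\<^sup>*\<^sup>* \<beta> \<beta>'"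
    by (rule datum_reduction)
  have "fde_entails TYPE('s) \<alpha>' \<beta>'"
    using assms(2) unfolding fde_entails_iff_verified
      g_rules_verified [OF \<alpha>'(2)] g_rules_verified [OF \<beta>'(2)] .
  then have "\<And>\<Gamma>. \<Gamma> |\<in>| \<alpha>' \<Longrightarrow> \<exists>\<Delta>. \<Delta> |\<in>| \<beta>' \<and> \<Delta> |\<subseteq>| \<Gamma>"
    using literal_datum_entails [OF assms(1) _ \<alpha>'(1) \<beta>'(1)] by blast
  then obtain \<gamma> where \<gamma>: "\<gamma> |\<subseteq>| \<beta>'" "analytic\<^sup>*\<^sup>* \<alpha>' \<gamma>"
    using Del_steps [of \<alpha>' \<beta>' "{||}"] by auto
  have "analytic\<^sup>*\<^sup>* \<alpha> \<gamma>"
    using g_rules_analytic [OF \<alpha>'(2)] \<gamma>(2) by simp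
  \<comment> \<open>Exp completes \<open>\<gamma>\<close> to \<open>\<beta>'\<close>; the reduction
    of \<open>\<beta>\<close> read backwards then leads to \<open>\<beta>\<close>.\<close>
  moreover have "synthetic\<^sup>*\<^sup>* \<gamma> \<beta>"
    using Exp_steps [of \<gamma> \<beta>'] g_rules_synthetic [OF \<beta>'(2)] \<gamma>(1)
    by (simp add: sup_absorb1)
  ultimately show ?thesis by (rule normal_deductionI)
qed

end
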